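(* For any set $\mathbf{SL}$ of Scott-Lemmon axioms, cut elimination holds for $\mathbf{SKt}+\mathbf{SL}$.
   Context: Formulae are in negation normal form over $a,\neg a,\lor,\land,\square,\blacksquare,\lozenge,\lozenge^{\bullet}$, where $\lozenge^{\bullet}$ is the past diamond (dual of $\blacksquare$), $\overline A$ is the nnf of $\neg A$. $\mathbf{SKt}$ is the shallow nested sequent calculus: $id$: $\Gamma,a,\overline a$; $cut$: from $\Gamma,A$ and $\Delta,\overline A$ infer $\Gamma,\Delta$; $\land$, $\lor$; $ctr$: from $\Gamma,\Delta,\Delta$ infer $\Gamma,\Delta$; $wk$: from $\Gamma$ infer $\Gamma,\Delta$; $rf$: from $\Gamma,\circ\{\Delta\}$ infer $\bullet\{\Gamma\},\Delta$; $rp$: from $\Gamma,\bullet\{\Delta\}$ infer $\circ\{\Gamma\},\Delta$; $\blacksquare$: from $\Gamma,\bullet\{A\}$ infer $\Gamma,\blacksquare A$; $\square$: from $\Gamma,\circ\{A\}$ infer $\Gamma,\square A$; $\lozenge^{\bullet}$: from $\Gamma,\bullet\{\Delta,A\}$ infer $\Gamma,\bullet\{\Delta\},\lozenge^{\bullet}A$; $\lozenge$: from $\Gamma,\circ\{\Delta,A\}$ infer $\Gamma,\circ\{\Delta\},\lozenge A$. A Scott-Lemmon axiom $\lozenge^h\square^i A\to\square^j\lozenge^k A$ has primitive form $(\lozenge^{\bullet})^h\lozenge^j A\to\lozenge^i(\lozenge^{\bullet})^k A$; $\mathbf{SKt}+\mathbf{SL}$ is $\mathbf{SKt}$ plus,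 for each axiom in $\mathbf{SL}$, the structural rule $sl(h,i,j,k)$: from $\Gamma,\circ^i\{\bullet^k\{\Delta\}\}$ infer $\Gamma,\bullet^h\{\circ^j\{\Delta\}\}$ ($\circ^n$, $\bullet^n$ denoting $n$-fold nesting). *)

theory Defs
  imports "HOL-Library.Multiset"
begin

datatype 'a fm =
    Atom 'a
  | NegAtom 'a
  | Or "'a fm" "'a fm"
  | And "'a fm" "'a fm"
  | Box "'a fm"
  | BBox "'a fm"   (* past box (black box) *)
  | Dia "'a fm"
  | BDia "'a fm"   (* past diamond, dual to BBox *)

text \<open>The negation normal form of the negation of a formula.\<close>

primrec neg :: "'a fm \<Rightarrow> 'a fm" where
  "neg (Atom a) = NegAtom a"
| "neg (NegAtom a) = Atom a"
| "neg (Or A B) = And (neg A) (neg B)"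
| "neg (And A B) = Or (neg A) (neg B)"
| "neg (Box A) = Dia (neg A)"
| "neg (BBox A) = BDia (neg A)"
| "neg (Dia A) = Box (neg A)"
| "neg (BDia A) = BBox (neg A)"

definition Imp :: "'a fm \<Rightarrow> 'a fm \<Rightarrow> 'a fm" where
  "Imp A B = Or (neg A) B"

text \<open>A nested sequent is a finite multiset of formulae and of nested sequents enclosed in
  a white (future) or black (past) bracket. Comma is multiset union; the empty sequent is allowed.\<close>

datatype 'a struc =
    Fm "'a fm"
  | White "'a struc multiset"
  | Black "'a struc multiset"

type_synonym 'a sequent = "'a struc multiset"

text \<open>The 0-fold nesting of a sequent is the sequent itself, whose elements are then simply
  joined with the surrounding context.\<close>

definition nest :: "('a sequent \<Rightarrow> 'a struc) \<Rightarrow> nat \<Rightarrow> 'a sequent \<Rightarrow> 'a sequent" where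
  "nest c n \<Delta> = ((\<lambda>\<Theta>. {#c \<Theta>#}) ^^ n) \<Delta>"

text \<open>Axioms are schematic in \<open>A\<close>, hence functions on formulae; an axiom determines
  its indices (lemma \<open>scott_lemmon_inject\<close> below).\<close>

definition scott_lemmon :: "nat \<Rightarrow> nat \<Rightarrow> nat \<Rightarrow> nat \<Rightarrow> 'a fm \<Rightarrow> 'a fm" where
  "scott_lemmon h i j k = (\<lambda>A. Imp ((Dia ^^ h) ((Box ^^ i) A)) ((Box ^^ j) ((Dia ^^ k) A)))"

text \<open>Derivability in SKt + SL. The cut rule is available iff the first argument is \<open>True\<close>.
  Rule \<open>sl\<close> is the structural form of the axiom's primitive form
  \<open>BDia^h Dia^j A \<longrightarrow> Dia^i BDia^k A\<close>.\<close>

inductive derivable :: "bool \<Rightarrow> ('a fm \<Rightarrow> 'a fm) set \<Rightarrow> 'a sequent \<Rightarrow> bool"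
  for with_cut :: bool and SL :: "('a fm \<Rightarrow> 'a fm) set" where
  ax: "derivable with_cut SL (\<Gamma> + {#Fm (Atom a), Fm (NegAtom a)#})"
| cut: "with_cut \<Longrightarrow> derivable with_cut SL (\<Gamma> + {#Fm A#}) \<Longrightarrow>
    derivable with_cut SL (\<Delta> + {#Fm (neg A)#}) \<Longrightarrow> derivable with_cut SL (\<Gamma> + \<Delta>)"
| conj: "derivable with_cut SL (\<Gamma> + {#Fm A#}) \<Longrightarrow> derivable with_cut SL (\<Gamma> + {#Fm B#}) \<Longrightarrow>
    derivable with_cut SL (\<Gamma> + {#Fm (And A B)#})"
| disj: "derivable with_cut SL (\<Gamma> + {#Fm A, Fm B#}) \<Longrightarrow>
    derivable with_cut SL (\<Gamma> + {#Fm (Or A B)#})"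
| ctr: "derivable with_cut SL (\<Gamma> + \<Delta> + \<Delta>) \<Longrightarrow> derivable with_cut SL (\<Gamma> + \<Delta>)"
| wk: "derivable with_cut SL \<Gamma> \<Longrightarrow> derivable with_cut SL (\<Gamma> + \<Delta>)"
| rf: "derivable with_cut SL (\<Gamma> + {#White \<Delta>#}) \<Longrightarrow> derivable with_cut SL ({#Black \<Gamma>#} + \<Delta>)"
| rp: "derivable with_cut SL (\<Gamma> + {#Black \<Delta>#}) \<Longrightarrow> derivable with_cut SL ({#White \<Gamma>#} + \<Delta>)"
| bbox: "derivable with_cut SL (\<Gamma> + {#Black {#Fm A#}#}) \<Longrightarrow>
    derivable with_cut SL (\<Gamma> + {#Fm (BBox A)#})"
| box: "derivable with_cut SL (\<Gamma> + {#White {#Fm A#}#}) \<Longrightarrow>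
    derivable with_cut SL (\<Gamma> + {#Fm (Box A)#})"
| bdia: "derivable with_cut SL (\<Gamma> + {#Black (\<Delta> + {#Fm A#})#}) \<Longrightarrow>
    derivable with_cut SL (\<Gamma> + {#Black \<Delta>, Fm (BDia A)#})"
| dia: "derivable with_cut SL (\<Gamma> + {#White (\<Delta> + {#Fm A#})#}) \<Longrightarrow>
    derivable with_cut SL (\<Gamma> + {#White \<Delta>, Fm (Dia A)#})"
| sl: "scott_lemmon h i j k \<in> SL \<Longrightarrow>
    derivable with_cut SL (\<Gamma> + nest White i (nest Black k \<Delta>)) \<Longrightarrow>
    derivable with_cut SL (\<Gamma> + nest Black h (nest White j \<Delta>))"

lemma neg_Dia_pow: "neg ((Dia ^^ n) A) = (Box ^^ n) (neg A)"
  by (induction n) auto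

lemma neg_Box_pow: "neg ((Box ^^ n) A) = (Dia ^^ n) (neg A)"
  by (induction n) auto

lemma Dia_pow_eq:
  assumes "\<And>C. A \<noteq> Dia C" "\<And>C. B \<noteq> Dia C" "(Dia ^^ m) A = (Dia ^^ n) B"
  shows "m = n \<and> A = B"
  using assms(3)
proof (induction m arbitrary: n)
  case 0
  then show ?case using assms(1) by (cases n) auto
next
  case (Suc m)
  then show ?case using assms(2) by (cases n) auto
qed

lemma Box_pow_eq:
  assumes "\<And>C. A \<noteq> Box C" "\<And>C. B \<noteq> Box C" "(Box ^^ m) A = (Box ^^ n) B"
  shows "m = n \<and> A = B"
  using assms(3)
proof (induction m arbitrary: n)
  case 0
  then show ?case using assms(1) by (cases n) auto
next
  case (Suc m)
  then show ?case using assms(2) by (cases n) auto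
qed

lemma Box_Dia_pow_eq:
  assumes "\<And>C. A \<noteq> Dia C" "\<And>C. A \<noteq> Box C"
    and "(Box ^^ m) ((Dia ^^ p) A) = (Box ^^ n) ((Dia ^^ q) A)"
  shows "m = n \<and> p = q"
proof -
  have "(Dia ^^ r) A \<noteq> Box C" for r C
    using assms(2) by (cases r) auto
  from Box_pow_eq[OF this this assms(3)] show ?thesis
    using Dia_pow_eq[OF assms(1) assms(1)] by blast
qed

lemma scott_lemmon_inject:
  "scott_lemmon h i j k = (scott_lemmon h' i' j' k' :: 'a fm \<Rightarrow> 'a fm) \<longleftrightarrow>
    h = h' \<and> i = i' \<and> j = j' \<and> k = k'"
proof
  assume "scott_lemmon h i j k = (scott_lemmon h' i' j' k' :: 'a fm \<Rightarrow> 'a fm)"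
  then have "scott_lemmon h i j k (Atom undefined) =
      (scott_lemmon h' i' j' k' (Atom undefined) :: 'a fm)"
    by simp
  then have
    "(Box ^^ h) ((Dia ^^ i) (NegAtom (undefined :: 'a))) = (Box ^^ h') ((Dia ^^ i') (NegAtom undefined))"
    "(Box ^^ j) ((Dia ^^ k) (Atom (undefined :: 'a))) = (Box ^^ j') ((Dia ^^ k') (Atom undefined))"
    by (auto simp: scott_lemmon_def Imp_def neg_Dia_pow neg_Box_pow)
  then show "h = h' \<and> i = i' \<and> j = j' \<and> k = k'"
    using Box_Dia_pow_eq[of "NegAtom (undefined :: 'a)" h i h' i']
      Box_Dia_pow_eq[of "Atom (undefined :: 'a)" j k j' k'] by simp
qed simp

end

theory Submission imports Defs begin

text \<open>Belnap-style argument. All rules are closed under replacing parametric occurrences of a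
  formula \<open>A\<close>, at any depth, by a sequent \<open>\<Theta>\<close>. Hence \<open>\<Theta>\<close> can replace the cut formula in
  the whole derivation of one premise of a cut, provided it can do so where the cut formula is
  principal. Doing this in both premises leaves only cuts in which both cut formulae are principal,
  and these reduce to cuts on immediate subformulae.\<close>

section \<open>Double negation, and replacement inside nested sequents\<close>

lemma neg_neg [simp]: "neg (neg A) = A"
  by (induction A) auto

text \<open>Any number of occurrences may be replaced, so that the copies created by a contraction are
  covered.\<close>

inductive replace :: "'a fm \<Rightarrow> 'a sequent \<Rightarrow> 'a sequent \<Rightarrow> 'a sequent \<Rightarrow> bool"
  for A :: "'a fm" and \<Theta> :: "'a sequent" where
  empty: "replace A \<Theta> {#} {#}"
| keep: "replace A \<Theta> S S' \<Longrightarrow> replace A \<Theta> (add_mset s S) (add_mset s S')"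
| hit: "replace A \<Theta> S S' \<Longrightarrow> replace A \<Theta> (add_mset (Fm A) S) (\<Theta> + S')"
| white: "replace A \<Theta> T T' \<Longrightarrow> replace A \<Theta> S S' \<Longrightarrow>
    replace A \<Theta> (add_mset (White T) S) (add_mset (White T') S')"
| black: "replace A \<Theta> T T' \<Longrightarrow> replace A \<Theta> S S' \<Longrightarrow>
    replace A \<Theta> (add_mset (Black T) S) (add_mset (Black T') S')"

lemma replace_refl: "replace A \<Theta> S S"
  by (induction S) (auto intro: replace.intros)

lemma replace_union:
  "replace A \<Theta> S S' \<Longrightarrow> replace A \<Theta> T T' \<Longrightarrow> replace A \<Theta> (S + T) (S' + T')"
  by (induction rule: replace.induct) (auto intro: replace.intros simp: add.assoc)

lemma replace_White: "replace A \<Theta> T T' \<Longrightarrow> replace A \<Theta> {#White T#} {#White T'#}"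
  by (rule replace.white[OF _ replace.empty])

lemma replace_Black: "replace A \<Theta> T T' \<Longrightarrow> replace A \<Theta> {#Black T#} {#Black T'#}"
  by (rule replace.black[OF _ replace.empty])

lemma replace_nest_White:
  "replace A \<Theta> T T' \<Longrightarrow> replace A \<Theta> (nest White n T) (nest White n T')"
  by (induction n) (auto simp: nest_def intro: replace_White)

lemma replace_nest_Black:
  "replace A \<Theta> T T' \<Longrightarrow> replace A \<Theta> (nest Black n T) (nest Black n T')"
  by (induction n) (auto simp: nest_def intro: replace_Black)

section \<open>Inversion of replacement\<close>

text \<open>Elements are added in some order, so the last one need not be \<open>s\<close>;
  induction on the replacement finds the step that handled \<open>s\<close>. The image
  \<open>M\<close> is a multiset because a hit puts all of \<open>\<Theta>\<close> in place of one
  formula.\<close>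

lemma replace_add_msetE:
  assumes "replace A \<Theta> (add_mset s S) R"
  obtains M S' where "R = M + S'" "replace A \<Theta> {#s#} M" "replace A \<Theta> S S'"
proof -
  have "\<exists>M S'. R = M + S' \<and> replace A \<Theta> {#s#} M \<and> replace A \<Theta> S S'"
    if "replace A \<Theta> X R" "X = add_mset s S" for X
    using that
  proof (induction arbitrary: S rule: replace.induct)
    case empty
    then show ?case by simp
  next
    case (keep U U' t)
    have t: "replace A \<Theta> {#t#} {#t#}" by (rule replace_refl)
    \<comment> \<open>Two one-element extensions are equal: either the added elements coincide or
      both remainders extend a common \<open>V\<close>.\<close>
    from keep.prems consider "t = s" "U = S"
      | V where "U = add_mset s V" "S = add_mset t V"
      by (auto simp: add_eq_conv_ex)
    then show ?case
    proof cases
      case 1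
      then show ?thesis using t keep.hyps
        by (intro exI[of _ "{#t#}"] exI[of _ U']) auto
    next
      case 2
      from keep.IH[OF 2(1)] obtain M S' where "U' = M + S'" "replace A \<Theta> {#s#} M"
        "replace A \<Theta> V S'" by blast
      then show ?thesis using replace_union[OF t, of V S'] 2
        by (intro exI[of _ M] exI[of _ "add_mset t S'"]) auto
    qed
  next
    case (hit U U')
    have t: "replace A \<Theta> {#Fm A#} \<Theta>" using replace.hit[OF replace.empty] by simp
    from hit.prems consider "Fm A = s" "U = S"
      | V where "U = add_mset s V" "S = add_mset (Fm A) V"
      by (auto simp: add_eq_conv_ex)
    then show ?case
    proof cases
      case 1
      then show ?thesis using t hit.hyps
        by (intro exI[of _ \<Theta>] exI[of _ U']) auto
    next
      case 2
      from hit.IH[OF 2(1)] obtain M S' where "U' = M + S'" "replace A \<Theta> {#s#} M"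
        "replace A \<Theta> V S'" by blast
      then show ?thesis using replace_union[OF t, of V S'] 2
        by (intro exI[of _ M] exI[of _ "\<Theta> + S'"]) (auto simp: ac_simps)
    qed
  next
    case (white T T' U U')
    have t: "replace A \<Theta> {#White T#} {#White T'#}" using white.hyps by (blast intro: replace_White)
    from white.prems consider "White T = s" "U = S"
      | V where "U = add_mset s V" "S = add_mset (White T) V"
      by (auto simp: add_eq_conv_ex)
    then show ?case
    proof cases
      case 1
      then show ?thesis using t white.hyps
        by (intro exI[of _ "{#White T'#}"] exI[of _ U']) auto
    next
      case 2
      from white.IH(2)[OF 2(1)] obtain M S' where "U' = M + S'" "replace A \<Theta> {#s#} M"
        "replace A \<Theta> V S'" by blast
      then show ?thesis using replace_union[OF t, of V S'] 2
        by (intro exI[of _ M] exI[of _ "add_mset (White T') S'"]) auto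
    qed
  next
    case (black T T' U U')
    have t: "replace A \<Theta> {#Black T#} {#Black T'#}" using black.hyps by (blast intro: replace_Black)
    from black.prems consider "Black T = s" "U = S"
      | V where "U = add_mset s V" "S = add_mset (Black T) V"
      by (auto simp: add_eq_conv_ex)
    then show ?case
    proof cases
      case 1
      then show ?thesis using t black.hyps
        by (intro exI[of _ "{#Black T'#}"] exI[of _ U']) auto
    next
      case 2
      from black.IH(2)[OF 2(1)] obtain M S' where "U' = M + S'" "replace A \<Theta> {#s#} M"
        "replace A \<Theta> V S'" by blast
      then show ?thesis using replace_union[OF t, of V S'] 2
        by (intro exI[of _ M] exI[of _ "add_mset (Black T') S'"]) auto
    qed
  qed
  with assms that show ?thesis by blast
qed

lemma replace_emptyD: "replace A \<Theta> {#} R \<Longrightarrow> R = {#}"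
  by (auto elim: replace.cases)

text \<open>Together with the inversions for formulae, brackets and nestings, this matches a
  replaced conclusion against the schema of a rule, giving one replacement per schematic
  part.\<close>

lemma replace_unionE:
  assumes "replace A \<Theta> (S + T) R"
  obtains S' T' where "R = S' + T'" "replace A \<Theta> S S'" "replace A \<Theta> T T'"
  using assms
proof (induction S arbitrary: R thesis)
  case empty
  from empty(1)[of "{#}" R] empty(2) show ?case by (simp add: replace_refl)
next
  case (add s S)
  from add.prems(2) obtain M R' where R: "R = M + R'" "replace A \<Theta> {#s#} M" "replace A \<Theta> (S + T) R'"
    by (auto elim: replace_add_msetE)
  from add.IH[OF _ R(3)] obtain S' T' where "R' = S' + T'" "replace A \<Theta> S S'" "replace A \<Theta> T T'"
    by blast
  then show ?case using add.prems(1)[of "M + S'" T'] R replace_union[OF R(2), of S S']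
    by (simp add: add.assoc)
qed

lemma replace_FmE:
  assumes "replace A \<Theta> {#Fm B#} R"
  obtains "R = {#Fm B#}" | "B = A" "R = \<Theta>"
  using assms by (auto elim!: replace.cases[of A \<Theta> "{#Fm B#}"] dest: replace_emptyD)

text \<open>The bracket may also be left alone by \<open>keep\<close>; reflexivity turns this into a
  replacement of its content, so a single shape remains.\<close>

lemma replace_WhiteE:
  assumes "replace A \<Theta> {#White T#} R"
  obtains T' where "R = {#White T'#}" "replace A \<Theta> T T'"
  using assms
  by (auto elim!: replace.cases[of A \<Theta> "{#White T#}"] dest: replace_emptyD intro: replace_refl)

lemma replace_BlackE:
  assumes "replace A \<Theta> {#Black T#} R"
  obtains T' where "R = {#Black T'#}" "replace A \<Theta> T T'"
  using assms
  by (auto elim!: replace.cases[of A \<Theta> "{#Black T#}"] dest: replace_emptyD intro: replace_refl)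

lemma replace_nest_WhiteE:
  assumes "replace A \<Theta> (nest White n T) R"
  obtains T' where "R = nest White n T'" "replace A \<Theta> T T'"
  using assms
proof (induction n arbitrary: R thesis)
  case (Suc n)
  from Suc.prems(2) obtain U where "R = {#White U#}" "replace A \<Theta> (nest White n T) U"
    by (auto simp: nest_def elim: replace_WhiteE)
  then show ?case using Suc.IH[of U] Suc.prems(1) by (auto simp: nest_def)
qed (simp add: nest_def)

lemma replace_nest_BlackE:
  assumes "replace A \<Theta> (nest Black n T) R"
  obtains T' where "R = nest Black n T'" "replace A \<Theta> T T'"
  using assms
proof (induction n arbitrary: R thesis)
  case (Suc n)
  from Suc.prems(2) obtain U where "R = {#Black U#}" "replace A \<Theta> (nest Black n T) U"
    by (auto simp: nest_def elim: replace_BlackE)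
  then show ?case using Suc.IH[of U] Suc.prems(1) by (auto simp: nest_def)
qed (simp add: nest_def)

section \<open>Principal formulae and closure of cut-free derivability under replacement\<close>

text \<open>\<open>principal SL A \<Gamma>\<close>: the sequent \<open>\<Gamma>, A\<close> follows, with \<open>A\<close> principal, from cut-free derivable
  premises.\<close>

fun principal :: "('a fm \<Rightarrow> 'a fm) set \<Rightarrow> 'a fm \<Rightarrow> 'a sequent \<Rightarrow> bool" where
  "principal SL (Atom a) \<Gamma> \<longleftrightarrow> Fm (NegAtom a) \<in># \<Gamma>"
| "principal SL (NegAtom a) \<Gamma> \<longleftrightarrow> Fm (Atom a) \<in># \<Gamma>"
| "principal SL (Or A B) \<Gamma> \<longleftrightarrow> derivable False SL (\<Gamma> + {#Fm A, Fm B#})"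
| "principal SL (And A B) \<Gamma> \<longleftrightarrow>
    derivable False SL (\<Gamma> + {#Fm A#}) \<and> derivable False SL (\<Gamma> + {#Fm B#})"
| "principal SL (Box A) \<Gamma> \<longleftrightarrow> derivable False SL (\<Gamma> + {#White {#Fm A#}#})"
| "principal SL (BBox A) \<Gamma> \<longleftrightarrow> derivable False SL (\<Gamma> + {#Black {#Fm A#}#})"
| "principal SL (Dia A) \<Gamma> \<longleftrightarrow>
    (\<exists>\<Gamma>' \<Delta>. \<Gamma> = \<Gamma>' + {#White \<Delta>#} \<and> derivable False SL (\<Gamma>' + {#White (\<Delta> + {#Fm A#})#}))"
| "principal SL (BDia A) \<Gamma> \<longleftrightarrow>
    (\<exists>\<Gamma>' \<Delta>. \<Gamma> = \<Gamma>' + {#Black \<Delta>#} \<and> derivable False SL (\<Gamma>' + {#Black (\<Delta> + {#Fm A#})#}))"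

text \<open>Induction on the derivation. The structural rules, \<open>sl\<close> included, mention
  no formula and are reapplied to the replaced parts. In a logical rule the principal formula is
  either kept, and the rule is reapplied, or hit, and then the replaced premises establish
  \<open>principal\<close> for \<open>A\<close>, so that \<open>hit\<close> applies.\<close>

lemma derivable_replace:
  assumes "derivable False SL S" and "replace A \<Theta> S R"
    and hit: "\<And>\<Gamma>. principal SL A \<Gamma> \<Longrightarrow> derivable False SL (\<Gamma> + \<Theta>)"
  shows "derivable False SL R"
proof -
  note congs = replace_union replace_White replace_Black replace_nest_White replace_nest_Black
    replace_refl
  show ?thesis
    using assms(1,2)
  proof (induction arbitrary: R rule: derivable.induct)
    case (ax \<Gamma> a)
    have "replace A \<Theta> (\<Gamma> + ({#Fm (Atom a)#} + {#Fm (NegAtom a)#})) R"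
      using ax by (simp add: add_mset_commute)
    then obtain \<Gamma>' M N where R: "R = \<Gamma>' + (M + N)"
      and M: "replace A \<Theta> {#Fm (Atom a)#} M" and N: "replace A \<Theta> {#Fm (NegAtom a)#} N"
      by (elim replace_unionE) blast
    \<comment> \<open>At most one of the two literals is hit, since they are different
      formulae.\<close>
    from M N consider "M = {#Fm (Atom a)#}" "N = {#Fm (NegAtom a)#}"
      | "A = Atom a" "M = \<Theta>" "N = {#Fm (NegAtom a)#}"
      | "A = NegAtom a" "M = {#Fm (Atom a)#}" "N = \<Theta>"
      by (elim replace_FmE) auto
    then show ?case
    proof cases
      case 1
      then show ?thesis using R derivable.ax[of False SL \<Gamma>' a] by (simp add: add_mset_commute)
    next
      case 2
      then show ?thesis using R hit[of "\<Gamma>' + N"] by (simp add: ac_simps)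
    next
      case 3
      then show ?thesis using R hit[of "\<Gamma>' + M"] by (simp add: ac_simps)
    qed
  next
    case (cut \<Gamma> B \<Delta>)
    then show ?case by simp
  next
    case (conj \<Gamma> B C)
    from conj.prems obtain \<Gamma>' M where R: "R = \<Gamma>' + M" and \<Gamma>: "replace A \<Theta> \<Gamma> \<Gamma>'"
      and M: "replace A \<Theta> {#Fm (And B C)#} M"
      by (elim replace_unionE) blast
    \<comment> \<open>Only the context is replaced; the active subformulae are kept by
      \<open>replace_refl\<close>.\<close>
    have "derivable False SL (\<Gamma>' + {#Fm B#})" "derivable False SL (\<Gamma>' + {#Fm C#})"
      by (intro conj.IH congs \<Gamma>)+
    with M show ?case unfolding R
      by (elim replace_FmE) (auto intro: derivable.conj[simplified] hit)
  next
    case (disj \<Gamma> B C)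
    from disj.prems obtain \<Gamma>' M where R: "R = \<Gamma>' + M" and \<Gamma>: "replace A \<Theta> \<Gamma> \<Gamma>'"
      and M: "replace A \<Theta> {#Fm (Or B C)#} M"
      by (elim replace_unionE) blast
    have "derivable False SL (\<Gamma>' + {#Fm B, Fm C#})"
      by (intro disj.IH congs \<Gamma>)+
    with M show ?case unfolding R
      by (elim replace_FmE) (auto intro: derivable.disj[simplified] hit)
  next
    case (ctr \<Gamma> \<Delta>)
    from ctr.prems obtain \<Gamma>' \<Delta>' where R: "R = \<Gamma>' + \<Delta>'" "replace A \<Theta> \<Gamma> \<Gamma>'" "replace A \<Theta> \<Delta> \<Delta>'"
      by (elim replace_unionE) blast
    \<comment> \<open>The same \<open>\<Delta>'\<close> is chosen for both copies, so contraction
      still applies.\<close>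
    have "derivable False SL (\<Gamma>' + \<Delta>' + \<Delta>')"
      by (intro ctr.IH congs R)
    then show ?case unfolding R by (rule derivable.ctr)
  next
    case (wk \<Gamma> \<Delta>)
    from wk.prems obtain \<Gamma>' \<Delta>' where R: "R = \<Gamma>' + \<Delta>'" "replace A \<Theta> \<Gamma> \<Gamma>'"
      by (elim replace_unionE) blast
    then show ?case using wk.IH by (auto intro: derivable.wk)
  next
    case (rf \<Gamma> \<Delta>)
    from rf.prems obtain \<Gamma>' \<Delta>' where R: "R = {#Black \<Gamma>'#} + \<Delta>'" "replace A \<Theta> \<Gamma> \<Gamma>'" "replace A \<Theta> \<Delta> \<Delta>'"
      by (elim replace_unionE replace_BlackE) blast
    have "derivable False SL (\<Gamma>' + {#White \<Delta>'#})"
      by (intro rf.IH congs R)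
    then show ?case unfolding R by (rule derivable.rf)
  next
    case (rp \<Gamma> \<Delta>)
    from rp.prems obtain \<Gamma>' \<Delta>' where R: "R = {#White \<Gamma>'#} + \<Delta>'" "replace A \<Theta> \<Gamma> \<Gamma>'" "replace A \<Theta> \<Delta> \<Delta>'"
      by (elim replace_unionE replace_WhiteE) blast
    have "derivable False SL (\<Gamma>' + {#Black \<Delta>'#})"
      by (intro rp.IH congs R)
    then show ?case unfolding R by (rule derivable.rp)
  next
    case (bbox \<Gamma> B)
    from bbox.prems obtain \<Gamma>' M where R: "R = \<Gamma>' + M" and \<Gamma>: "replace A \<Theta> \<Gamma> \<Gamma>'"
      and M: "replace A \<Theta> {#Fm (BBox B)#} M"
      by (elim replace_unionE) blast
    have "derivable False SL (\<Gamma>' + {#Black {#Fm B#}#})"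
      by (intro bbox.IH congs \<Gamma>)+
    with M show ?case unfolding R
      by (elim replace_FmE) (auto intro: derivable.bbox[simplified] hit)
  next
    case (box \<Gamma> B)
    from box.prems obtain \<Gamma>' M where R: "R = \<Gamma>' + M" and \<Gamma>: "replace A \<Theta> \<Gamma> \<Gamma>'"
      and M: "replace A \<Theta> {#Fm (Box B)#} M"
      by (elim replace_unionE) blast
    have "derivable False SL (\<Gamma>' + {#White {#Fm B#}#})"
      by (intro box.IH congs \<Gamma>)+
    with M show ?case unfolding R
      by (elim replace_FmE) (auto intro: derivable.box[simplified] hit)
  next
    case (bdia \<Gamma> \<Delta> B)
    have "replace A \<Theta> (\<Gamma> + {#Black \<Delta>#} + {#Fm (BDia B)#}) R"
      using bdia.prems by (simp add: add_mset_commute)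
    then obtain \<Gamma>' \<Delta>' M where R: "R = \<Gamma>' + {#Black \<Delta>'#} + M" and \<Gamma>: "replace A \<Theta> \<Gamma> \<Gamma>'"
      "replace A \<Theta> \<Delta> \<Delta>'" and M: "replace A \<Theta> {#Fm (BDia B)#} M"
      by (elim replace_unionE replace_BlackE) blast
    have D: "derivable False SL (\<Gamma>' + {#Black (\<Delta>' + {#Fm B#})#})"
      by (intro bdia.IH congs \<Gamma>)+
    from M show ?case
    proof (cases rule: replace_FmE)
      case 1
      then show ?thesis using R derivable.bdia[OF D] by (simp add: add_mset_commute)
    next
      case 2
      have "principal SL A (\<Gamma>' + {#Black \<Delta>'#})"
        unfolding 2(1)[symmetric] principal.simps using D by blast
      then show ?thesis unfolding R 2 by (rule hit)
    qed
  next
    case (dia \<Gamma> \<Delta> B)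
    have "replace A \<Theta> (\<Gamma> + {#White \<Delta>#} + {#Fm (Dia B)#}) R"
      using dia.prems by (simp add: add_mset_commute)
    then obtain \<Gamma>' \<Delta>' M where R: "R = \<Gamma>' + {#White \<Delta>'#} + M" and \<Gamma>: "replace A \<Theta> \<Gamma> \<Gamma>'"
      "replace A \<Theta> \<Delta> \<Delta>'" and M: "replace A \<Theta> {#Fm (Dia B)#} M"
      by (elim replace_unionE replace_WhiteE) blast
    have D: "derivable False SL (\<Gamma>' + {#White (\<Delta>' + {#Fm B#})#})"
      by (intro dia.IH congs \<Gamma>)+
    from M show ?case
    proof (cases rule: replace_FmE)
      case 1
      then show ?thesis using R derivable.dia[OF D] by (simp add: add_mset_commute)
    next
      case 2
      have "principal SL A (\<Gamma>' + {#White \<Delta>'#})"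
        unfolding 2(1)[symmetric] principal.simps using D by blast
      then show ?thesis unfolding R 2 by (rule hit)
    qed
  next
    case (sl h i j k \<Gamma> \<Delta>)
    \<comment> \<open>The nestings consist of brackets only, so replacement acts inside
      \<open>\<Gamma>\<close> and \<open>\<Delta>\<close> and the shape required by
      \<open>sl\<close> survives.\<close>
    from sl.prems obtain \<Gamma>' \<Delta>' where R: "R = \<Gamma>' + nest Black h (nest White j \<Delta>')"
      "replace A \<Theta> \<Gamma> \<Gamma>'" "replace A \<Theta> \<Delta> \<Delta>'"
      by (elim replace_unionE replace_nest_BlackE replace_nest_WhiteE) blast
    have "derivable False SL (\<Gamma>' + nest White i (nest Black k \<Delta>'))"
      by (intro sl.IH congs R)
    then show ?case unfolding R by (rule derivable.sl[OF sl.hyps(1)])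
  qed
qed

section \<open>Reduction to principal cuts\<close>

text \<open>The formula is fixed and the contexts are arbitrary, so that induction on the formula
  provides smaller cuts in any context.\<close>

definition cut_admissible :: "('a fm \<Rightarrow> 'a fm) set \<Rightarrow> 'a fm \<Rightarrow> bool" where
  "cut_admissible SL A \<longleftrightarrow> (\<forall>\<Gamma> \<Delta>. derivable False SL (\<Gamma> + {#Fm A#}) \<longrightarrow>
    derivable False SL (\<Delta> + {#Fm (neg A)#}) \<longrightarrow> derivable False SL (\<Gamma> + \<Delta>))"

lemma cut_admissibleD:
  assumes "cut_admissible SL A" "derivable False SL (\<Gamma> + {#Fm A#})"
    "derivable False SL (\<Delta> + {#Fm (neg A)#})"
  shows "derivable False SL (\<Gamma> + \<Delta>)"
  using assms unfolding cut_admissible_def by blast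

text \<open>The premises of a cut swap roles, as negation is involutive. Hence one connective of
  each dual pair suffices.\<close>

lemma cut_admissible_neg: "cut_admissible SL A \<Longrightarrow> cut_admissible SL (neg A)"
  unfolding cut_admissible_def neg_neg by (subst union_commute) blast

text \<open>Two nested uses of \<open>derivable_replace\<close>: the outer one puts
  \<open>\<Delta>\<close> for \<open>A\<close> in the first derivation; wherever \<open>A\<close> is
  principal there, the inner one puts the context of that inference for \<open>neg A\<close> in the
  second. What remains is the assumed case.\<close>

lemma cut_admissibleI_principal:
  assumes "\<And>\<Gamma> \<Delta>. principal SL A \<Gamma> \<Longrightarrow> principal SL (neg A) \<Delta> \<Longrightarrow> derivable False SL (\<Gamma> + \<Delta>)"
  shows "cut_admissible SL A"
  unfolding cut_admissible_def
proof (intro allI impI)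
  fix \<Gamma> \<Delta>
  assume \<Gamma>: "derivable False SL (\<Gamma> + {#Fm A#})" and \<Delta>: "derivable False SL (\<Delta> + {#Fm (neg A)#})"
  have replace: "replace B \<Theta> (\<Xi> + {#Fm B#}) (\<Xi> + \<Theta>)" for B :: "'a fm" and \<Theta> \<Xi>
    using replace.hit[OF replace_refl, of B \<Theta> \<Xi>] by (simp add: union_commute)
  show "derivable False SL (\<Gamma> + \<Delta>)"
  proof (rule derivable_replace[OF \<Gamma> replace])
    fix \<Gamma>' assume \<Gamma>': "principal SL A \<Gamma>'"
    have "derivable False SL (\<Delta> + \<Gamma>')"
    proof (rule derivable_replace[OF \<Delta> replace])
      fix \<Delta>' assume "principal SL (neg A) \<Delta>'"
      from assms[OF \<Gamma>' this] show "derivable False SL (\<Delta>' + \<Gamma>')"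
        by (simp add: union_commute)
    qed
    then show "derivable False SL (\<Gamma>' + \<Delta>)"
      by (simp add: union_commute)
  qed
qed

section \<open>Principal cuts on compound formulae\<close>

text \<open>A cut on \<open>A\<close> and then one on \<open>B\<close> remove both disjuncts; each
  brings in a copy of \<open>\<Gamma>\<close>, and contraction merges the two.\<close>

lemma cut_reduce_And:
  assumes "cut_admissible SL A" "cut_admissible SL B"
    "principal SL (And A B) \<Gamma>" "principal SL (Or (neg A) (neg B)) \<Delta>"
  shows "derivable False SL (\<Gamma> + \<Delta>)"
proof -
  from assms(3,4) have A: "derivable False SL (\<Gamma> + {#Fm A#})"
    and B: "derivable False SL (\<Gamma> + {#Fm B#})"
    and AB: "derivable False SL (\<Delta> + {#Fm (neg B)#} + {#Fm (neg A)#})"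
    by (simp_all add: add_mset_commute)
  have "derivable False SL (\<Gamma> + \<Delta> + {#Fm (neg B)#})"
    using cut_admissibleD[OF assms(1) A AB] by (simp only: add.assoc)
  from cut_admissibleD[OF assms(2) B this] have "derivable False SL (\<Gamma> + (\<Gamma> + \<Delta>))" .
  then show ?thesis
    using derivable.ctr[of False SL \<Delta> \<Gamma>] by (simp add: ac_simps)
qed

text \<open>The display rules bring \<open>A\<close> and \<open>neg A\<close> to the top level. The two contexts are first weakened
  to a common one, since afterwards they are enclosed in separate brackets and can only be merged by
  contraction.\<close>

lemma cut_reduce_Box:
  assumes "cut_admissible SL A" "principal SL (Box A) \<Gamma>" "principal SL (Dia (neg A)) \<Delta>"
  shows "derivable False SL (\<Gamma> + \<Delta>)"
proof -
  from assms(3) obtain \<Delta>' \<Theta> where \<Delta>: "\<Delta> = \<Delta>' + {#White \<Theta>#}"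
    and D: "derivable False SL (\<Delta>' + {#White (\<Theta> + {#Fm (neg A)#})#})" by auto
  let ?X = "\<Gamma> + \<Delta>'"
  have "derivable False SL (?X + {#White {#Fm A#}#})"
    using derivable.wk[of False SL "\<Gamma> + {#White {#Fm A#}#}" \<Delta>'] assms(2) by simp
  then have 1: "derivable False SL ({#Black ?X#} + {#Fm A#})"
    by (rule derivable.rf)
  have "derivable False SL (?X + {#White (\<Theta> + {#Fm (neg A)#})#})"
    using derivable.wk[OF D, of \<Gamma>] by (simp add: ac_simps)
  then have 2: "derivable False SL ({#Black ?X#} + \<Theta> + {#Fm (neg A)#})"
    unfolding add.assoc[of "{#Black ?X#}"] by (rule derivable.rf)
  have "derivable False SL (\<Theta> + {#Black ?X#} + {#Black ?X#})"
    using cut_admissibleD[OF assms(1) 1 2] by (simp add: ac_simps)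
  \<comment> \<open>\<open>rp\<close> undoes the display: \<open>\<Theta>\<close> returns into a
    white bracket and \<open>?X\<close> is released.\<close>
  then have "derivable False SL ({#White \<Theta>#} + ?X)"
    by (rule derivable.rp[OF derivable.ctr])
  then show ?thesis
    by (simp add: \<Delta> ac_simps)
qed

text \<open>Mirror image of the future case, with \<open>rf\<close> and \<open>rp\<close>, and white
  and black, exchanged.\<close>

lemma cut_reduce_BBox:
  assumes "cut_admissible SL A" "principal SL (BBox A) \<Gamma>" "principal SL (BDia (neg A)) \<Delta>"
  shows "derivable False SL (\<Gamma> + \<Delta>)"
proof -
  from assms(3) obtain \<Delta>' \<Theta> where \<Delta>: "\<Delta> = \<Delta>' + {#Black \<Theta>#}"
    and D: "derivable False SL (\<Delta>' + {#Black (\<Theta> + {#Fm (neg A)#})#})" by auto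
  let ?X = "\<Gamma> + \<Delta>'"
  have "derivable False SL (?X + {#Black {#Fm A#}#})"
    using derivable.wk[of False SL "\<Gamma> + {#Black {#Fm A#}#}" \<Delta>'] assms(2) by simp
  then have 1: "derivable False SL ({#White ?X#} + {#Fm A#})"
    by (rule derivable.rp)
  have "derivable False SL (?X + {#Black (\<Theta> + {#Fm (neg A)#})#})"
    using derivable.wk[OF D, of \<Gamma>] by (simp add: ac_simps)
  then have 2: "derivable False SL ({#White ?X#} + \<Theta> + {#Fm (neg A)#})"
    unfolding add.assoc[of "{#White ?X#}"] by (rule derivable.rp)
  have "derivable False SL (\<Theta> + {#White ?X#} + {#White ?X#})"
    using cut_admissibleD[OF assms(1) 1 2] by (simp add: ac_simps)
  then have "derivable False SL ({#Black \<Theta>#} + ?X)"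
    by (rule derivable.rf[OF derivable.ctr])
  then show ?thesis
    by (simp add: \<Delta> ac_simps)
qed

section \<open>Induction on the cut formula and elimination of all cuts\<close>

text \<open>In a principal cut each context contains the literal dual to its cut formula, so the
  joined contexts already form an axiom.\<close>

lemma cut_admissible_Atom: "cut_admissible SL (Atom a)"
proof (rule cut_admissibleI_principal)
  fix \<Gamma> \<Delta>
  assume "principal SL (Atom a) \<Gamma>" and "principal SL (neg (Atom a)) \<Delta>"
  then have "Fm (NegAtom a) \<in># \<Gamma>" and "Fm (Atom a) \<in># \<Delta>"
    by simp_all
  then obtain \<Gamma>' \<Delta>' where "\<Gamma> = add_mset (Fm (NegAtom a)) \<Gamma>'" "\<Delta> = add_mset (Fm (Atom a)) \<Delta>'"
    by (meson multi_member_split)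
  then show "derivable False SL (\<Gamma> + \<Delta>)"
    using derivable.ax[of False SL "\<Gamma>' + \<Delta>'" a] by (simp add: add_mset_commute)
qed

lemma cut_admissible_And:
  "cut_admissible SL A \<Longrightarrow> cut_admissible SL B \<Longrightarrow> cut_admissible SL (And A B)"
  by (rule cut_admissibleI_principal, unfold neg.simps) (rule cut_reduce_And)

lemma cut_admissible_Box: "cut_admissible SL A \<Longrightarrow> cut_admissible SL (Box A)"
  by (rule cut_admissibleI_principal, unfold neg.simps) (rule cut_reduce_Box)

lemma cut_admissible_BBox: "cut_admissible SL A \<Longrightarrow> cut_admissible SL (BBox A)"
  by (rule cut_admissibleI_principal, unfold neg.simps) (rule cut_reduce_BBox)

text \<open>Disjunctions and diamonds are treated as negations of conjunctions and boxes over the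
  negated parts, whose admissibility follows from the induction hypotheses by
  \<open>cut_admissible_neg\<close>.\<close>

lemma cut_admissible: "cut_admissible SL A"
proof (induction A)
  case (Atom a)
  show ?case by (rule cut_admissible_Atom)
next
  case (NegAtom a)
  show ?case using cut_admissible_neg[OF cut_admissible_Atom] by simp
next
  case (Or A B)
  then show ?case
    using cut_admissible_neg[OF cut_admissible_And[of SL "neg A" "neg B"]]
    by (simp add: cut_admissible_neg)
next
  case (And A B)
  then show ?case by (rule cut_admissible_And)
next
  case (Box A)
  then show ?case by (rule cut_admissible_Box)
next
  case (BBox A)
  then show ?case by (rule cut_admissible_BBox)
next
  case (Dia A)
  then show ?case
    using cut_admissible_neg[OF cut_admissible_Box[of SL "neg A"]]
    by (simp add: cut_admissible_neg)
next
  case (BDia A)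
  then show ?case
    using cut_admissible_neg[OF cut_admissible_BBox[of SL "neg A"]]
    by (simp add: cut_admissible_neg)
qed

text \<open>By induction both premises of a cut already have cut-free derivations, so
  \<open>cut_admissible\<close> applies; every other rule is simply repeated.\<close>

theorem theorem5p5:
  fixes SL :: "('a fm \<Rightarrow> 'a fm) set" and \<Gamma> :: "'a sequent"
  assumes "SL \<subseteq> {scott_lemmon h i j k | h i j k. True}"
    and "derivable True SL \<Gamma>"
  shows "derivable False SL \<Gamma>"
  using assms(2)
proof (induction rule: derivable.induct)
  case (cut \<Gamma> A \<Delta>)
  then show ?case using cut_admissibleD[OF cut_admissible] by blast
next
  case ax
  show ?case by (rule derivable.ax)
next
  case conj
  show ?case by (rule derivable.conj[OF conj.IH])
next
  case disj
  show ?case by (rule derivable.disj[OF disj.IH])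
next
  case ctr
  show ?case by (rule derivable.ctr[OF ctr.IH])
next
  case wk
  show ?case by (rule derivable.wk[OF wk.IH])
next
  case rf
  show ?case by (rule derivable.rf[OF rf.IH])
next
  case rp
  show ?case by (rule derivable.rp[OF rp.IH])
next
  case bbox
  show ?case by (rule derivable.bbox[OF bbox.IH])
next
  case box
  show ?case by (rule derivable.box[OF box.IH])
next
  case bdia
  show ?case by (rule derivable.bdia[OF bdia.IH])
next
  case dia
  show ?case by (rule derivable.dia[OF dia.IH])
next
  case sl
  show ?case by (rule derivable.sl[OF sl.hyps(1) sl.IH])
qed

end
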